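(* Let $n\ge 1$ be an integer and $0<s<1$. For any $0<p<1$, the equation $$(\partial_t-\Delta)^s u(x,t)=x_1u^p(x,t)\quad\text{in } \mathbb{R}^n\times\mathbb{R},$$ where $x=(x_1,\dots,x_n)$, possesses no bounded positive classical solution $u$ such that, for each $t\in\mathbb{R}$, $u(\cdot,t)$ is monotone increasing in the $x_1$ direction (i.e. $u(x_1,x',t)\le u(y_1,x',t)$ whenever $x_1<y_1$ and $x'\in\mathbb{R}^{n-1}$).
   Context: For $0<s<1$ the fully fractional heat (master) operator is $$(\partial_t-\Delta)^s u(x,t):=C_{n,s}\int_{-\infty}^{t}\int_{\mathbb{R}^n}\frac{u(x,t)-u(y,\tau)}{(t-\tau)^{\frac n2+1+s}}\,e^{-\frac{|x-y|^2}{4(t-\tau)}}\,dy\,d\tau,\qquad C_{n,s}=\frac{1}{(4\pi)^{n/2}|\Gamma(-s)|},$$ where the integral in $y$ is in the sense of Cauchy principal value. $\mathcal{L}(\mathbb{R}^n\times\mathbb{R})$ is the set of $u\in L^1_{\mathrm{loc}}(\mathbb{R}^n\times\mathbb{R})$ such that $\int_{-\infty}^t\int_{\mathbb{R}^n}\frac{|u(x,\tau)|e^{-|x|^2/(4(t-\tau))}}{1+(t-\tau)^{\frac n2+1+s}}\,dx\,d\tau<\infty$ for every $t\in\mathbb{R}$. Parabolic Hölder spaces $C^{2\alpha,\alpha}_{x,t}(\mathbb{R}^n\times\mathbb{R})$: (i) for $0<\alpha\le\frac12$, $u$ belongs to it if there is $C>0$ with $|u(x,t)-u(y,\tau)|\le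 C(|x-y|+|t-\tau|^{1/2})^{2\alpha}$ for all $x,y\in\mathbb{R}^n$, $t,\tau\in\mathbb{R}$; (ii) for $\frac12<\alpha\le1$, if $u$ is $\alpha$-Hölder continuous in $t$ uniformly in $x$, and $\nabla_x u$ is $(2\alpha-1)$-Hölder continuous in $x$ uniformly in $t$ and $(\alpha-\frac12)$-Hölder continuous in $t$ uniformly in $x$; (iii) for $\alpha>1$, if $\partial_tu, D_x^2u\in C^{2\alpha-2,\alpha-1}_{x,t}(\mathbb{R}^n\times\mathbb{R})$. The local space $C^{2\alpha,\alpha}_{x,t,\mathrm{loc}}$ is defined analogously, with the conditions required on bounded subsets of $\mathbb{R}^n\times\mathbb{R}$. The condition "$u\in C^{2s+\epsilon,s+\epsilon}_{x,t,\mathrm{loc}}(\mathbb{R}^n\times\mathbb{R})$ for some $\epsilon>0$" means $u\in C^{2\alpha,\alpha}_{x,t,\mathrm{loc}}(\mathbb{R}^n\times\mathbb{R})$ for some $\alpha>s$. A classical (entire) solution is a function $u\in C^{2s+\epsilon,s+\epsilon}_{x,t,\mathrm{loc}}(\mathbb{R}^n\times\mathbb{R})\cap\mathcal{L}(\mathbb{R}^n\times\mathbb{R})$ for some $\epsilon>0$ satisfying the equation at every point of $\mathbb{R}^n\times\mathbb{R}$. Positive means $u>0$ everywhere; bounded means $\sup_{\mathbb{R}^n\times\mathbb{R}}u<\infty$. *)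

theory Defs
  imports "HOL-Analysis.Analysis"
begin

text \<open>
  Space is \<open>real ^ 'n\<close>, so the dimension is \<open>CARD('n)\<close>. Functions on space-time are written
  curried, as \<open>u x t\<close>.
\<close>

definition L1_loc :: "(real ^ 'n::finite \<Rightarrow> real \<Rightarrow> real) \<Rightarrow> bool" where
  "L1_loc u \<longleftrightarrow> (\<forall>K. compact K \<longrightarrow> (\<lambda>(x, t). u x t) absolutely_integrable_on K)"

definition slowly_increasing :: "real \<Rightarrow> (real ^ 'n::finite \<Rightarrow> real \<Rightarrow> real) \<Rightarrow> bool" where
  "slowly_increasing s u \<longleftrightarrow> L1_loc u \<and>
     (\<forall>t. (\<integral>\<^sup>+\<tau>\<in>{..<t}. (\<integral>\<^sup>+x. ennreal
             (\<bar>u x \<tau>\<bar> * exp (- (norm x)\<^sup>2 / (4 * (t - \<tau>)))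
               / (1 + (t - \<tau>) powr (real CARD('n) / 2 + 1 + s)))
           \<partial>lebesgue) \<partial>lebesgue) < \<infinity>)"

text \<open>
  The local parabolic Hoelder spaces \<open>C\<^bsup>2\<alpha>,\<alpha>\<^esup>\<close>. Every seminorm is required to be finite on each
  bounded set of space-time; the constant may depend on that set. For \<open>\<alpha> > 1\<close> the condition is
  recursive in \<open>\<alpha>\<close>, and \<open>g\<close>, \<open>H\<close>, \<open>v\<close> are the spatial gradient, the spatial Hessian (whose
  membership in the lower-order space is meant entrywise) and the time derivative.
\<close>

inductive parabolic_holder_loc :: "real \<Rightarrow> (real ^ 'n::finite \<Rightarrow> real \<Rightarrow> real) \<Rightarrow> bool" where
  low: "parabolic_holder_loc \<alpha> u"
    if "0 < \<alpha>" "\<alpha> \<le> 1/2"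
       "\<forall>B. bounded B \<longrightarrow> (\<exists>C>0. \<forall>x t y \<tau>. (x, t) \<in> B \<longrightarrow> (y, \<tau>) \<in> B \<longrightarrow>
          \<bar>u x t - u y \<tau>\<bar> \<le> C * (norm (x - y) + \<bar>t - \<tau>\<bar> powr (1/2)) powr (2 * \<alpha>))"
| mid: "parabolic_holder_loc \<alpha> u"
    if "1/2 < \<alpha>" "\<alpha> \<le> 1"
       "\<forall>x t. GDERIV (\<lambda>x. u x t) x :> g x t"
       "\<forall>B. bounded B \<longrightarrow> (\<exists>C>0. \<forall>x t \<tau>. (x, t) \<in> B \<longrightarrow> (x, \<tau>) \<in> B \<longrightarrow>
          \<bar>u x t - u x \<tau>\<bar> \<le> C * \<bar>t - \<tau>\<bar> powr \<alpha>)"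
       "\<forall>B. bounded B \<longrightarrow> (\<exists>C>0. \<forall>x y t. (x, t) \<in> B \<longrightarrow> (y, t) \<in> B \<longrightarrow>
          norm (g x t - g y t) \<le> C * norm (x - y) powr (2 * \<alpha> - 1))"
       "\<forall>B. bounded B \<longrightarrow> (\<exists>C>0. \<forall>x t \<tau>. (x, t) \<in> B \<longrightarrow> (x, \<tau>) \<in> B \<longrightarrow>
          norm (g x t - g x \<tau>) \<le> C * \<bar>t - \<tau>\<bar> powr (\<alpha> - 1/2))"
| high: "parabolic_holder_loc \<alpha> u"
    if "1 < \<alpha>"
       "\<forall>x t. GDERIV (\<lambda>x. u x t) x :> g x t"
       "\<forall>x t. ((\<lambda>x. g x t) has_derivative (\<lambda>h. H x t *v h)) (at x)"
       "\<forall>x t. ((\<lambda>t. u x t) has_real_derivative v x t) (at t)"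
       "parabolic_holder_loc (\<alpha> - 1) v"
       "\<forall>i j. parabolic_holder_loc (\<alpha> - 1) (\<lambda>x t. H x t $ i $ j)"

definition has_pv_integral ::
    "(real ^ 'n::finite \<Rightarrow> real) \<Rightarrow> real ^ 'n \<Rightarrow> real \<Rightarrow> bool" where
  "has_pv_integral f x I \<longleftrightarrow>
     (\<forall>\<epsilon>>0. f absolutely_integrable_on {y. \<epsilon> < norm (x - y)}) \<and>
     ((\<lambda>\<epsilon>. integral {y. \<epsilon> < norm (x - y)} f) \<longlongrightarrow> I) (at_right 0)"

text \<open>
  \<open>has_master_op s u x t c\<close> states that the iterated integral defining
  \<open>(\<partial>\<^sub>t - \<Delta>)\<^sup>s u(x,t)\<close> exists and that the operator has the value \<open>c\<close> there. It is a relation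
  because the totalised integral would return a meaningless default on divergence.
  Here \<open>F \<tau>\<close> is the inner principal value over \<open>y\<close>; it need only exist for almost all \<open>\<tau>\<close>.
\<close>

definition has_master_op ::
    "real \<Rightarrow> (real ^ 'n::finite \<Rightarrow> real \<Rightarrow> real) \<Rightarrow> real ^ 'n \<Rightarrow> real \<Rightarrow> real \<Rightarrow> bool" where
  "has_master_op s u x t c \<longleftrightarrow>
     (\<exists>F. (AE \<tau> in lebesgue. \<tau> < t \<longrightarrow>
             has_pv_integral
               (\<lambda>y. (u x t - u y \<tau>) / (t - \<tau>) powr (real CARD('n) / 2 + 1 + s)
                      * exp (- (norm (x - y))\<^sup>2 / (4 * (t - \<tau>)))) x (F \<tau>)) \<and>
          F absolutely_integrable_on {..<t} \<and>
          c = 1 / ((4 * pi) powr (real CARD('n) / 2) * \<bar>Gamma (- s)\<bar>) * integral {..<t} F)"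

definition classical_solution ::
    "real \<Rightarrow> (real ^ 'n::finite \<Rightarrow> real \<Rightarrow> real) \<Rightarrow> (real ^ 'n \<Rightarrow> real \<Rightarrow> real) \<Rightarrow> bool" where
  "classical_solution s f u \<longleftrightarrow>
     (\<exists>\<alpha>>s. parabolic_holder_loc \<alpha> u) \<and> slowly_increasing s u \<and>
     (\<forall>x t. has_master_op s u x t (f x (u x t)))"

end

theory Submission
  imports Defs "HOL-Probability.Distributions"
begin

text \<open>
  Touch \<open>u\<close> from below, after taking the power \<open>1 - p\<close>, by a paraboloid
  \<open>f(x,t) = t - |x - a|\<^sup>2\<close> on \<open>t \<le> 1\<close>: at a maximum point \<open>(x\<^sub>0,t\<^sub>0)\<close> of
  \<open>f / u\<^bsup>1-p\<^esup>\<close>, with \<open>\<delta>\<close> the reciprocal of the maximum, concavity of \<open>r \<mapsto> r\<^bsup>1-p\<^esup>\<close> gives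
  \<open>u(x\<^sub>0,t\<^sub>0) - u \<le> A (f(x\<^sub>0,t\<^sub>0) - f)\<close> in the past, where
  \<open>A = \<delta> u(x\<^sub>0,t\<^sub>0)\<^bsup>p\<^esup> / (1 - p)\<close>, and also \<open>u(x\<^sub>0,t\<^sub>0) - u \<le> A\<close>. Integrating the first bound
  over \<open>t\<^sub>0 - 1 < \<tau> < t\<^sub>0\<close> and the second over the earlier times bounds the master operator at
  \<open>(x\<^sub>0,t\<^sub>0)\<close> by \<open>C A\<close> with \<open>C\<close> independent of \<open>a\<close>. The equation thus gives
  \<open>x\<^sub>0 $ k \<le> C \<delta> / (1 - p)\<close>, while \<open>\<delta> \<le> (sup u)\<^bsup>1-p\<^esup>\<close>; this fails once \<open>a $ k\<close> is large.
\<close>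

section \<open>Tangent inequality for powers; joint continuity of parabolic Hoelder
  functions\<close>

text \<open>Weighted AM-GM applied to \<open>a powr p * b powr (1 - p)\<close>. This is the tangent
  line bound for the concave function \<open>r powr (1 - p)\<close> at \<open>a\<close>, multiplied
  by \<open>a powr p\<close> to clear the negative power.\<close>

lemma powr_concave_tangent:
  fixes a b p :: real
  assumes "0 < a" "0 < b" "0 \<le> p" "p \<le> 1"
  shows "(1 - p) * (a - b) \<le> a powr p * (a powr (1 - p) - b powr (1 - p))"
proof -
  have "a powr p * b powr (1 - p) \<le> p * a + (1 - p) * b"
    using Youngs_inequality_0[of p "1 - p" a b] assms by simp
  moreover have "a powr p * a powr (1 - p) = a"
    using assms by (simp flip: powr_add)
  ultimately show ?thesis by (simp add: algebra_simps)
qed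

text \<open>Triangle inequality through \<open>(x, t0)\<close>: the modulus \<open>m\<close>
  controls the time increment uniformly in \<open>x\<close>, so continuity in space is needed at the
  single time \<open>t0\<close>. The value \<open>m 0 = 0\<close> covers nearby points with
  \<open>t = t0\<close>.\<close>

lemma isCont_prod_if_locally_uniform:
  fixes u :: "'a::real_normed_vector \<Rightarrow> real \<Rightarrow> real"
  assumes cont: "isCont (\<lambda>x. u x t0) x0"
    and m: "(m \<longlongrightarrow> 0) (at_right 0)" "m 0 = 0"
    and bound: "\<And>x t. x \<in> ball x0 1 \<Longrightarrow> t \<in> ball t0 1 \<Longrightarrow> \<bar>u x t - u x t0\<bar> \<le> m \<bar>t - t0\<bar>"
  shows "isCont (\<lambda>z. u (fst z) (snd z)) (x0, t0)"
proof -
  have "isCont (\<lambda>r. m \<bar>r\<bar>) 0"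
    using m unfolding isCont_def
    by (auto intro!: filterlim_compose[OF m(1)] simp: filterlim_at eventually_at_filter intro!: tendsto_eq_intros)
  then have mt: "((\<lambda>t. m \<bar>t\<bar>) \<longlongrightarrow> 0) (nhds 0)"
    using m(2) tendsto_at_iff_tendsto_nhds[of "\<lambda>r. m \<bar>r\<bar>" 0] by (simp add: isCont_def)
  have id: "((\<lambda>z. z) \<longlongrightarrow> (x0, t0)) (nhds (x0, t0))"
    by (rule filterlim_ident)
  have "((\<lambda>z. snd z - t0) \<longlongrightarrow> 0) (nhds (x0, t0))"
    using tendsto_diff[OF tendsto_snd[OF id] tendsto_const[of t0]] by simp
  from filterlim_compose[OF mt this]
  have 1: "((\<lambda>z. m \<bar>snd z - t0\<bar>) \<longlongrightarrow> 0) (nhds (x0, t0))" .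
  have "((\<lambda>x. u x t0) \<longlongrightarrow> u x0 t0) (nhds x0)"
    using cont tendsto_at_iff_tendsto_nhds[of "\<lambda>x. u x t0" x0] by (simp add: isCont_def)
  from filterlim_compose[OF this, of fst "nhds (x0, t0)"]
  have "((\<lambda>z. u (fst z) t0) \<longlongrightarrow> u x0 t0) (nhds (x0, t0))"
    using tendsto_fst[OF id] by simp
  then have 2: "((\<lambda>z. \<bar>u (fst z) t0 - u x0 t0\<bar>) \<longlongrightarrow> 0) (nhds (x0, t0))"
    by (simp add: tendsto_rabs_zero_iff LIM_zero_iff)
  have "eventually (\<lambda>z. z \<in> ball x0 1 \<times> ball t0 1) (nhds (x0, t0))"
    by (rule eventually_nhds_in_open) (auto intro: open_Times)
  then have "eventually (\<lambda>z. norm (u (fst z) (snd z) - u x0 t0)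
      \<le> m \<bar>snd z - t0\<bar> + \<bar>u (fst z) t0 - u x0 t0\<bar>) (nhds (x0, t0))"
  proof eventually_elim
    case (elim z)
    then show ?case using bound[of "fst z" "snd z"] by (auto simp: mem_Times_iff)
  qed
  from Lim_null_comparison[OF this] tendsto_add[OF 1 2]
  have "((\<lambda>z. u (fst z) (snd z) - u x0 t0) \<longlongrightarrow> 0) (nhds (x0, t0))" by simp
  then show ?thesis
    using tendsto_at_iff_tendsto_nhds[of "\<lambda>z. u (fst z) (snd z)" "(x0, t0)"]
    by (simp add: isCont_def LIM_zero_iff)
qed

text \<open>Provides the continuity that makes a quotient involving \<open>u\<close> attain its
  maximum on a compact set. In the range \<alpha> > 1 the induction hypothesis makes the time
  derivative \<open>v\<close> continuous, hence bounded on a compact cylinder, so \<open>u\<close>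
  is Lipschitz in time there.\<close>

lemma parabolic_holder_loc_isCont:
  assumes "parabolic_holder_loc \<alpha> u"
  shows "isCont (\<lambda>z. u (fst z) (snd z)) z"
  using assms
proof (induction arbitrary: z rule: parabolic_holder_loc.induct)
  case (low \<alpha> u)
  obtain x0 t0 where z: "z = (x0, t0)" by force
  define B where "B = ball x0 1 \<times> ball t0 1"
  have "bounded B" by (auto simp: B_def intro: bounded_Times)
  with low(3) obtain C where C: "\<And>x t y \<tau>. (x, t) \<in> B \<Longrightarrow> (y, \<tau>) \<in> B \<Longrightarrow>
          \<bar>u x t - u y \<tau>\<bar> \<le> C * (norm (x - y) + \<bar>t - \<tau>\<bar> powr (1/2)) powr (2 * \<alpha>)"
    by blast
  have "eventually (\<lambda>w. w \<in> B) (at z)"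
    unfolding B_def z by (rule eventually_at_in_open') (auto intro: open_Times)
  then have "eventually (\<lambda>w. norm (u (fst w) (snd w) - u x0 t0)
      \<le> C * (norm (fst w - x0) + \<bar>snd w - t0\<bar> powr (1/2)) powr (2 * \<alpha>)) (at z)"
    by eventually_elim (auto intro!: C simp: B_def)
  moreover have fs: "(fst \<longlongrightarrow> x0) (at z)" "(snd \<longlongrightarrow> t0) (at z)"
    unfolding z using tendsto_fst[OF tendsto_ident_at, of "(x0,t0)"]
      tendsto_snd[OF tendsto_ident_at, of "(x0,t0)"] by auto
  have n: "((\<lambda>w. norm (fst w - x0)) \<longlongrightarrow> 0) (at z)"
    using fs(1) by (simp add: tendsto_norm_zero_iff LIM_zero_iff)
  have a: "((\<lambda>w. \<bar>snd w - t0\<bar>) \<longlongrightarrow> 0) (at z)"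
    using fs(2) by (simp add: tendsto_rabs_zero_iff LIM_zero_iff)
  have "((\<lambda>w. \<bar>snd w - t0\<bar> powr (1/2)) \<longlongrightarrow> 0) (at z)"
    by (rule tendsto_zero_powrI[OF a tendsto_const]) auto
  from tendsto_add[OF n this]
  have na: "((\<lambda>w. norm (fst w - x0) + \<bar>snd w - t0\<bar> powr (1/2)) \<longlongrightarrow> 0) (at z)" by simp
  have "((\<lambda>w. (norm (fst w - x0) + \<bar>snd w - t0\<bar> powr (1/2)) powr (2 * \<alpha>)) \<longlongrightarrow> 0) (at z)"
    by (rule tendsto_zero_powrI[OF na tendsto_const]) (use low in auto)
  from tendsto_mult_right_zero[OF this]
  have "((\<lambda>w. C * (norm (fst w - x0) + \<bar>snd w - t0\<bar> powr (1/2)) powr (2 * \<alpha>)) \<longlongrightarrow> 0) (at z)" .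
  ultimately have "((\<lambda>w. u (fst w) (snd w) - u x0 t0) \<longlongrightarrow> 0) (at z)"
    by (rule Lim_null_comparison)
  then show ?case by (simp add: isCont_def LIM_zero_iff z)
next
  case (mid \<alpha> u g)
  obtain x0 t0 where z: "z = (x0, t0)" by force
  define B where "B = ball x0 1 \<times> ball t0 1"
  have "bounded B" by (auto simp: B_def intro: bounded_Times)
  with mid(4) obtain C where C: "\<And>x t \<tau>. (x, t) \<in> B \<Longrightarrow> (x, \<tau>) \<in> B \<Longrightarrow>
          \<bar>u x t - u x \<tau>\<bar> \<le> C * \<bar>t - \<tau>\<bar> powr \<alpha>"
    by blast
  show ?case unfolding z
  proof (rule isCont_prod_if_locally_uniform)
    show "isCont (\<lambda>x. u x t0) x0"
      using mid(3) by (auto simp: gderiv_def intro: has_derivative_continuous)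
    have "((\<lambda>r. r powr \<alpha>) \<longlongrightarrow> 0) (at_right (0::real))"
      by (rule tendsto_zero_powrI[OF tendsto_ident_at tendsto_const])
        (use mid in \<open>auto simp: eventually_at_filter\<close>)
    then show "((\<lambda>r. C * r powr \<alpha>) \<longlongrightarrow> 0) (at_right 0)"
      by (rule tendsto_mult_right_zero)
  qed (auto intro!: C simp: B_def)
next
  case (high \<alpha> u g H v)
  obtain x0 t0 where z: "z = (x0, t0)" by force
  have "continuous_on (cball x0 1 \<times> cball t0 1) (\<lambda>z. v (fst z) (snd z))"
    using high by (auto intro!: continuous_at_imp_continuous_on)
  then have "compact ((\<lambda>z. v (fst z) (snd z)) ` (cball x0 1 \<times> cball t0 1))"
    by (intro compact_continuous_image compact_Times) auto
  then obtain V where V: "\<And>x t. x \<in> cball x0 1 \<Longrightarrow> t \<in> cball t0 1 \<Longrightarrow> \<bar>v x t\<bar> \<le> V"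
    by (force dest!: compact_imp_bounded simp: bounded_iff)
  show ?case unfolding z
  proof (rule isCont_prod_if_locally_uniform)
    show "isCont (\<lambda>x. u x t0) x0"
      using high(2) by (auto simp: gderiv_def intro: has_derivative_continuous)
    show "((\<lambda>r. V * r) \<longlongrightarrow> 0) (at_right 0)"
      by (rule tendsto_mult_right_zero) (rule tendsto_ident_at)
    fix x t assume x: "x \<in> ball x0 1" and t: "t \<in> ball t0 1"
    have "norm (u x t - u x t0) \<le> V * norm (t - t0)"
    proof (rule field_differentiable_bound[of "cball t0 1" "u x" "v x"])
      show "(u x has_field_derivative v x r) (at r within cball t0 1)" for r
        using high(4) by (auto intro: has_field_derivative_at_within)
    qed (use x t V in auto)
    then show "\<bar>u x t - u x t0\<bar> \<le> V * \<bar>t - t0\<bar>" by simp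
  qed auto
qed

section \<open>Gaussian integrals\<close>

text \<open>Used twice below: with \<open>c = sqrt h\<close> for parabolic scaling, and with
  \<open>c = -1\<close> for reflection in a point.\<close>

lemma
  fixes f :: "'a::euclidean_space \<Rightarrow> real"
  assumes c: "c \<noteq> 0" and [measurable]: "f \<in> borel_measurable borel"
  shows integrable_lborel_affine_iff:
      "integrable lborel (\<lambda>x. f (t + c *\<^sub>R x)) \<longleftrightarrow> integrable lborel f"
    and integral_lborel_affine:
      "integral\<^sup>L lborel f = \<bar>c\<bar> ^ DIM('a) * (\<integral>x. f (t + c *\<^sub>R x) \<partial>lborel)"
proof -
  let ?D = "density (distr lborel borel (\<lambda>x::'a. t + c *\<^sub>R x)) (\<lambda>_. ennreal (\<bar>c\<bar> ^ DIM('a)))"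
  have D: "(lborel :: 'a measure) = ?D"
    using lborel_affine[OF c, of t] by (simp add: ennreal_power)
  have "integrable lborel f \<longleftrightarrow> integrable ?D f"
    by (subst D) (rule refl)
  also have "\<dots> \<longleftrightarrow> integrable lborel (\<lambda>x. f (t + c *\<^sub>R x))"
    using c by (simp add: integrable_density integrable_distr_eq)
  finally show "integrable lborel (\<lambda>x. f (t + c *\<^sub>R x)) \<longleftrightarrow> integrable lborel f" ..
  have "integral\<^sup>L lborel f = integral\<^sup>L ?D f"
    by (subst D) (rule refl)
  also have "\<dots> = \<bar>c\<bar> ^ DIM('a) * (\<integral>x. f (t + c *\<^sub>R x) \<partial>lborel)"
    by (simp add: integral_density integral_distr)
  finally show "integral\<^sup>L lborel f = \<bar>c\<bar> ^ DIM('a) * (\<integral>x. f (t + c *\<^sub>R x) \<partial>lborel)" .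
qed

text \<open>The integrand is a product over coordinates of multiples of the normal density with
  standard deviation 2. Its rate 1/8 is half of the heat rate 1/4, which leaves room to absorb a
  polynomial factor.\<close>

lemma integrable_gaussian:
  "integrable lborel (\<lambda>x::'a::euclidean_space. exp (- (norm x)\<^sup>2 / 8))"
proof (rule integrableI_nonneg)
  have n: "normal_density 0 2 = (\<lambda>x. exp (- x\<^sup>2 / 8) / sqrt (8 * pi))"
    by (auto simp: normal_density_def fun_eq_iff)
  have "integrable lborel (\<lambda>x::real. sqrt (8 * pi) * normal_density 0 2 x)"
    by (intro integrable_mult_right integrable_normal_density) simp
  then have "integrable lborel (\<lambda>x::real. exp (- x\<^sup>2 / 8))"
    by (simp add: n)
  then have fin: "(\<integral>\<^sup>+x. ennreal (exp (- x\<^sup>2 / 8)) \<partial>lborel) < \<infinity>"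
    by (simp add: integrable_iff_bounded)
  have "(norm x)\<^sup>2 = (\<Sum>b\<in>Basis. (x \<bullet> b)\<^sup>2)" for x :: 'a
    unfolding power2_norm_eq_inner euclidean_inner[of x x] by (simp add: power2_eq_square)
  then have "exp (- (norm x)\<^sup>2 / 8) = (\<Prod>b\<in>Basis. exp (- (x \<bullet> b)\<^sup>2 / 8))" for x :: 'a
    by (simp add: exp_sum[symmetric] sum_negf sum_divide_distrib[symmetric])
  then have "(\<integral>\<^sup>+x. ennreal (exp (- (norm x)\<^sup>2 / 8)) \<partial>(lborel::'a measure))
      = (\<integral>\<^sup>+x. (\<Prod>b\<in>Basis. ennreal (exp (- (x \<bullet> b)\<^sup>2 / 8))) \<partial>(lborel::'a measure))"
    by (simp add: prod_ennreal)
  also have "\<dots> = (\<Prod>b\<in>(Basis::'a set). \<integral>\<^sup>+x. ennreal (exp (- x\<^sup>2 / 8)) \<partial>lborel)"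
    by (rule nn_integral_lborel_prod) auto
  also have "\<dots> < \<infinity>"
    using fin by (simp add: power_less_top_ennreal)
  finally show "(\<integral>\<^sup>+x. ennreal (exp (- (norm x)\<^sup>2 / 8)) \<partial>(lborel::'a measure)) < \<infinity>" .
qed auto

text \<open>The heat moment at time 1, without the factor normalising the heat kernel. The type
  argument makes visible that it depends on the dimension alone.\<close>

definition gauss_moment :: "'a::euclidean_space itself \<Rightarrow> real" where
  "gauss_moment _ = (\<integral>x. (1 + (norm (x::'a))\<^sup>2) * exp (- (norm x)\<^sup>2 / 4) \<partial>lborel)"

lemma integrable_gauss_moment:
  "integrable lborel (\<lambda>x::'a::euclidean_space. (1 + (norm x)\<^sup>2) * exp (- (norm x)\<^sup>2 / 4))"
proof (rule Bochner_Integration.integrable_bound)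
  show "integrable lborel (\<lambda>x::'a. 8 * exp (- (norm x)\<^sup>2 / 8))"
    by (intro integrable_mult_right integrable_gaussian)
  have "(1 + r) * exp (- r / 4) \<le> 8 * exp (- r / 8)" if "r \<ge> 0" for r :: real
  proof -
    have "1 + r \<le> 8 * exp (r / 8)"
      using exp_ge_add_one_self[of "r / 8"] by linarith
    then have "(1 + r) * exp (- r / 4) \<le> 8 * exp (r / 8) * exp (- r / 4)"
      by (rule mult_right_mono) simp
    also have "\<dots> = 8 * exp (- r / 8)" by (simp flip: exp_add)
    finally show ?thesis .
  qed
  then show "AE x::'a in lborel. norm ((1 + (norm x)\<^sup>2) * exp (- (norm x)\<^sup>2 / 4))
      \<le> norm (8 * exp (- (norm x)\<^sup>2 / 8))"
    by auto
qed measurable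

lemma gauss_moment_nonneg: "0 \<le> gauss_moment TYPE('a::euclidean_space)"
  unfolding gauss_moment_def by (intro integral_nonneg_AE AE_I2) auto

text \<open>Substitute \<open>y = x + sqrt h *\<^sub>R w\<close>: the Jacobian contributes
  \<open>h powr (real DIM('a) / 2)\<close> and the weight one further factor
  \<open>h\<close>.\<close>

lemma
  fixes x :: "'a::euclidean_space"
  assumes h: "h > 0"
  shows integrable_heat_moment:
      "integrable lborel (\<lambda>y. (h + (norm (y - x))\<^sup>2) * exp (- (norm (x - y))\<^sup>2 / (4 * h)))"
    and integral_heat_moment:
      "(\<integral>y. (h + (norm (y - x))\<^sup>2) * exp (- (norm (x - y))\<^sup>2 / (4 * h)) \<partial>lborel)
        = h powr (real DIM('a) / 2) * h * gauss_moment TYPE('a)"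
proof -
  let ?f = "\<lambda>y. (h + (norm (y - x))\<^sup>2) * exp (- (norm (x - y))\<^sup>2 / (4 * h))"
  have [simp]: "sqrt h \<noteq> 0" using h by simp
  have eq: "?f (x + sqrt h *\<^sub>R w) = h * ((1 + (norm w)\<^sup>2) * exp (- (norm w)\<^sup>2 / 4))" for w
    using h by (simp add: power_mult_distrib algebra_simps)
  have m: "?f \<in> borel_measurable borel" by measurable
  have "integrable lborel (\<lambda>w. ?f (x + sqrt h *\<^sub>R w))"
    unfolding eq by (intro integrable_mult_right integrable_gauss_moment)
  then show "integrable lborel ?f"
    by (rule iffD1[OF integrable_lborel_affine_iff[OF \<open>sqrt h \<noteq> 0\<close> m]])
  have "\<bar>sqrt h\<bar> ^ DIM('a) = h powr (real DIM('a) / 2)"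
    using h by (simp add: powr_half_sqrt[symmetric] powr_powr flip: powr_realpow)
  then show "integral\<^sup>L lborel ?f = h powr (real DIM('a) / 2) * h * gauss_moment TYPE('a)"
    unfolding integral_lborel_affine[OF \<open>sqrt h \<noteq> 0\<close> m, of x] eq gauss_moment_def by simp
qed

text \<open>The integrand is odd under reflection in \<open>x\<close>, and the truncated region is
  invariant under it. First-order terms therefore vanish at every truncation level
  \<open>e\<close>.\<close>

lemma
  fixes x v :: "'a::euclidean_space"
  assumes h: "h > 0"
  shows integrable_heat_odd: "integrable lborel
      (\<lambda>y. indicator {y. e < norm (x - y)} y * (((y - x) \<bullet> v) * exp (- (norm (x - y))\<^sup>2 / (4 * h))))"
    and integral_heat_odd: "(\<integral>y. indicator {y. e < norm (x - y)} y *
      (((y - x) \<bullet> v) * exp (- (norm (x - y))\<^sup>2 / (4 * h))) \<partial>lborel) = 0"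
proof -
  let ?f = "\<lambda>y. indicator {y. e < norm (x - y)} y * (((y - x) \<bullet> v) * exp (- (norm (x - y))\<^sup>2 / (4 * h)))"
  let ?g = "\<lambda>y. (h + (norm (y - x))\<^sup>2) * exp (- (norm (x - y))\<^sup>2 / (4 * h))"
  have [measurable]: "{y. e < norm (x - y)} \<in> sets borel"
    by measurable
  have m: "?f \<in> borel_measurable borel" by measurable
  show "integrable lborel ?f"
  proof (rule Bochner_Integration.integrable_bound)
    show "integrable lborel (\<lambda>y. norm v * (1 + 1 / h) * ?g y)"
      by (intro integrable_mult_right integrable_heat_moment h)
    have "norm (?f y) \<le> norm v * (1 + 1 / h) * ?g y" for y
    proof -
      define r where "r = norm (y - x)"
      \<comment> \<open>The linear weight is dominated by the quadratic one, whose integrability is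
        known; the constant may depend on \<open>h\<close>.\<close>
      have "r \<le> 1 + r\<^sup>2" using zero_le_power2[of "r - 1/2"] by (simp add: power2_diff power2_eq_square algebra_simps)
      also have "\<dots> \<le> (1 + 1 / h) * (h + r\<^sup>2)"
        using h by (simp add: field_simps)
      finally have r: "r \<le> (1 + 1 / h) * (h + r\<^sup>2)" .
      have "norm (?f y) \<le> \<bar>(y - x) \<bullet> v\<bar> * exp (- (norm (x - y))\<^sup>2 / (4 * h))"
        by (auto simp: abs_mult indicator_def)
      also have "\<dots> \<le> (r * norm v) * exp (- (norm (x - y))\<^sup>2 / (4 * h))"
        unfolding r_def by (intro mult_right_mono Cauchy_Schwarz_ineq2) simp
      also have "\<dots> \<le> ((1 + 1 / h) * (h + r\<^sup>2) * norm v) * exp (- (norm (x - y))\<^sup>2 / (4 * h))"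
        by (intro mult_right_mono r) auto
      finally show ?thesis by (simp add: r_def mult_ac)
    qed
    then show "AE y in lborel. norm (?f y) \<le> norm (norm v * (1 + 1 / h) * ?g y)"
      by (intro AE_I2) (auto intro: order_trans[OF _ abs_ge_self])
  qed (use m in simp)
  have "?f (2 *\<^sub>R x + (-1) *\<^sub>R y) = - ?f y" for y
    by (auto simp: indicator_def norm_minus_commute scaleR_2 algebra_simps)
  then have "integral\<^sup>L lborel ?f = - integral\<^sup>L lborel ?f"
    by (subst integral_lborel_affine[OF _ m, of "-1" "2 *\<^sub>R x"]) auto
  then show "integral\<^sup>L lborel ?f = 0" by simp
qed

section \<open>One-sided bounds for the principal value and the master operator\<close>

text \<open>On each truncated region the linear part of the majorant integrates to zero and the
  nonnegative quadratic part to at most its integral over the whole space. This bound is independent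
  of the truncation, so it survives the limit.\<close>

lemma pv_heat_upper_bound:
  fixes d :: "real ^ 'n::finite \<Rightarrow> real"
  assumes h: "h > 0" and a: "a \<ge> 0"
    and pv: "has_pv_integral (\<lambda>y. d y / h powr N * exp (- (norm (x - y))\<^sup>2 / (4 * h))) x I"
    and d: "\<And>y. d y \<le> a * (h + (norm (y - x))\<^sup>2) + b * ((y - x) \<bullet> v)"
  shows "I \<le> a * h powr (real CARD('n) / 2 + 1 - N) * gauss_moment TYPE(real ^ 'n)"
proof -
  define f where "f y = d y / h powr N * exp (- (norm (x - y))\<^sup>2 / (4 * h))" for y
  define q where "q y = a / h powr N * ((h + (norm (y - x))\<^sup>2) * exp (- (norm (x - y))\<^sup>2 / (4 * h)))" for y
  define l where "l y = ((y - x) \<bullet> v) * exp (- (norm (x - y))\<^sup>2 / (4 * h))" for y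
  have pv: "has_pv_integral f x I"
    using pv by (simp only: f_def[abs_def])
  have q: "integrable lborel q"
    unfolding q_def by (intro integrable_mult_right integrable_heat_moment h)
  have q0: "q y \<ge> 0" for y using a h by (simp add: q_def)
  have le: "f y \<le> q y + b / h powr N * l y" for y
  proof -
    have "f y \<le> (a * (h + (norm (y - x))\<^sup>2) + b * ((y - x) \<bullet> v)) / h powr N
        * exp (- (norm (x - y))\<^sup>2 / (4 * h))"
      unfolding f_def using h by (intro mult_right_mono divide_right_mono d) auto
    also have "\<dots> = q y + b / h powr N * l y"
      using h by (simp add: q_def l_def field_simps)
    finally show ?thesis .
  qed
  have "integral {y. e < norm (x - y)} f \<le> integral\<^sup>L lborel q" if "e > 0" for e
  proof -
    let ?S = "{y. e < norm (x - y)}"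
    have S[measurable]: "?S \<in> sets borel" by measurable
    have f: "f absolutely_integrable_on ?S"
      using pv that by (auto simp: has_pv_integral_def)
    have i1: "integrable lborel (\<lambda>y. indicator ?S y * q y)"
      using integrable_mult_indicator[of ?S lborel q] q by simp
    have i2: "integrable lborel (\<lambda>y. b / h powr N * (indicator ?S y * l y))"
      unfolding l_def by (intro integrable_mult_right integrable_heat_odd h)
    have g: "integrable lborel (\<lambda>y. indicator ?S y * q y + b / h powr N * (indicator ?S y * l y))"
      by (intro Bochner_Integration.integrable_add i1 i2)
    have "integral ?S f = (\<integral>y. indicator ?S y * f y \<partial>lebesgue)"
      using set_lebesgue_integral_eq_integral(2)[OF f] by (simp add: set_lebesgue_integral_def)
    also have "\<dots> \<le> (\<integral>y. indicator ?S y * q y + b / h powr N * (indicator ?S y * l y) \<partial>lebesgue)"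
    \<comment> \<open>\<open>f\<close> is only known to be Lebesgue measurable, so the comparison
      takes place in \<open>lebesgue\<close>; the Borel majorant then moves back to
      \<open>lborel\<close>.\<close>
    proof (rule integral_mono)
      show "integrable lebesgue (\<lambda>y. indicator ?S y * f y)"
        using f by (simp add: set_integrable_def)
      show "integrable lebesgue (\<lambda>y. indicator ?S y * q y + b / h powr N * (indicator ?S y * l y))"
        by (rule iffD2[OF integrable_completion[OF borel_measurable_integrable[OF g]] g])
      show "indicator ?S y * f y \<le> indicator ?S y * q y + b / h powr N * (indicator ?S y * l y)" for y
        using le[of y] by (auto simp: indicator_def)
    qed
    also have "\<dots> = (\<integral>y. indicator ?S y * q y + b / h powr N * (indicator ?S y * l y) \<partial>lborel)"
      using g by (intro integral_completion borel_measurable_integrable)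
    also have "\<dots> = (\<integral>y. indicator ?S y * q y \<partial>lborel)
        + b / h powr N * (\<integral>y. indicator ?S y * l y \<partial>lborel)"
      by (subst Bochner_Integration.integral_add[OF i1 i2]) simp
    also have "(\<integral>y. indicator ?S y * l y \<partial>lborel) = 0"
      unfolding l_def by (rule integral_heat_odd[OF h])
    also have "(\<integral>y. indicator ?S y * q y \<partial>lborel) + b / h powr N * 0 \<le> integral\<^sup>L lborel q"
      unfolding mult_zero_right add_0_right
      by (rule integral_mono[OF i1 q]) (use q0 in \<open>auto simp: indicator_def\<close>)
    finally show ?thesis .
  qed
  then have ev: "eventually (\<lambda>e. integral {y. e < norm (x - y)} f \<le> integral\<^sup>L lborel q) (at_right 0)"
    by (auto simp: eventually_at_filter)
  have "((\<lambda>e. integral {y. e < norm (x - y)} f) \<longlongrightarrow> I) (at_right 0)"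
    using pv by (simp add: has_pv_integral_def)
  then have "I \<le> integral\<^sup>L lborel q"
    by (rule tendsto_upperbound[OF _ ev]) simp
  also have "\<dots> = a * h powr (real CARD('n) / 2 + 1 - N) * gauss_moment TYPE(real ^ 'n)"
    using h integral_heat_moment[OF h, of x] by (simp add: q_def[abs_def] powr_add powr_diff)
  finally show ?thesis .
qed

text \<open>For positive \<open>h\<close> this is the smaller of the two powers:
  \<open>h powr (- s)\<close> is integrable at 0 because \<open>s < 1\<close>, and
  \<open>h powr (- 1 - s)\<close> at infinity because \<open>0 < s\<close>. The value 0 for
  \<open>h \<le> 0\<close> allows integration over the whole line.\<close>

definition time_kernel :: "real \<Rightarrow> real \<Rightarrow> real" where
  "time_kernel s h = (if h \<le> 0 then 0 else if h \<le> 1 then h powr (- s) else h powr (- 1 - s))"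

lemma integrable_time_kernel:
  assumes "0 < s" "s < 1"
  shows "integrable lebesgue (time_kernel s)"
proof -
  have "time_kernel s absolutely_integrable_on {0..1}"
  proof (rule nonnegative_absolutely_integrable_1)
    have "(\<lambda>h. h powr (- s)) integrable_on {0..1}"
      using has_integral_powr_from_0[of "- s" 1] assms by (auto simp: integrable_on_def)
    then show "time_kernel s integrable_on {0..1}"
      by (rule integrable_eq) (auto simp: time_kernel_def)
  qed (simp add: time_kernel_def)
  moreover have "time_kernel s absolutely_integrable_on {1..}"
  proof (rule nonnegative_absolutely_integrable_1)
    have "(\<lambda>h. h powr (- 1 - s)) integrable_on {1..}"
      using has_integral_powr_to_inf[of "- 1 - s" 1] assms by (auto simp: integrable_on_def)
    then show "time_kernel s integrable_on {1..}"
      by (rule integrable_eq) (auto simp: time_kernel_def)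
  qed (simp add: time_kernel_def)
  ultimately have "time_kernel s absolutely_integrable_on ({0..1} \<union> {1..})"
    by (intro set_integrable_Un) auto
  also have "{0..1} \<union> {1..} = {0::real..}" by auto
  finally have "integrable lebesgue (\<lambda>h. indicator {0..} h *\<^sub>R time_kernel s h)"
    by (simp add: set_integrable_def)
  then show ?thesis
    by (rule back_subst[of "integrable lebesgue"]) (auto simp: time_kernel_def indicator_def)
qed

text \<open>The constant depends on \<open>s\<close> and the dimension only, not on the function or
  the point; the final contradiction rests on this uniformity.\<close>

definition master_bound :: "real \<Rightarrow> 'n::finite itself \<Rightarrow> real" where
  "master_bound s _ = 1 / ((4 * pi) powr (real CARD('n) / 2) * \<bar>Gamma (- s)\<bar>)
     * gauss_moment TYPE(real ^ 'n) * integral\<^sup>L lebesgue (time_kernel s)"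

lemma master_bound_nonneg: "0 \<le> master_bound s TYPE('n::finite)"
  unfolding master_bound_def
  by (intro mult_nonneg_nonneg gauss_moment_nonneg integral_nonneg_AE) (auto simp: time_kernel_def)

text \<open>The quadratic bound \<open>near\<close> serves time lags up to 1, where it gains a
  factor \<open>t - \<tau>\<close> against the singularity; the constant bound \<open>far\<close>
  serves longer lags, where the quadratic bound would not decay fast enough. The vector
  \<open>v\<close> is arbitrary since its term averages out.\<close>

lemma master_op_upper_bound:
  fixes u :: "real ^ 'n::finite \<Rightarrow> real \<Rightarrow> real"
  assumes s: "0 < s" "s < 1" and op: "has_master_op s u x t c" and A: "A \<ge> 0"
    and far: "\<And>y \<tau>. \<tau> < t \<Longrightarrow> u x t - u y \<tau> \<le> A"
    and near: "\<And>y \<tau>. \<tau> < t \<Longrightarrow>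
      u x t - u y \<tau> \<le> A * ((t - \<tau>) + (norm (y - x))\<^sup>2 + (y - x) \<bullet> v)"
  shows "c \<le> master_bound s TYPE('n) * A"
proof -
  let ?N = "real CARD('n) / 2 + 1 + s" and ?G = "gauss_moment TYPE(real ^ 'n)"
  from op obtain F where
    F: "AE \<tau> in lebesgue. \<tau> < t \<longrightarrow> has_pv_integral
               (\<lambda>y. (u x t - u y \<tau>) / (t - \<tau>) powr ?N
                      * exp (- (norm (x - y))\<^sup>2 / (4 * (t - \<tau>)))) x (F \<tau>)"
    and int: "F absolutely_integrable_on {..<t}"
    and c: "c = 1 / ((4 * pi) powr (real CARD('n) / 2) * \<bar>Gamma (- s)\<bar>) * integral {..<t} F"
    unfolding has_master_op_def by blast
  have bound: "I \<le> A * ?G * time_kernel s (t - \<tau>)"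
    if \<tau>: "\<tau> < t" and pv: "has_pv_integral (\<lambda>y. (u x t - u y \<tau>) / (t - \<tau>) powr ?N
                      * exp (- (norm (x - y))\<^sup>2 / (4 * (t - \<tau>)))) x I" for \<tau> I
  proof (cases "t - \<tau> \<le> 1")
    case True
    have "I \<le> A * (t - \<tau>) powr (real CARD('n) / 2 + 1 - ?N) * ?G"
      by (rule pv_heat_upper_bound[OF _ A pv, where b = A and v = v])
        (use near[OF \<tau>] \<tau> in \<open>auto simp: distrib_left\<close>)
    then show ?thesis using True \<tau> by (simp add: time_kernel_def mult_ac)
  next
    case False
    then have h: "t - \<tau> > 0" by simp
    \<comment> \<open>The constant \<open>A\<close> is at most \<open>A / (t - \<tau>)\<close> times
      the weight \<open>(t - \<tau>) + (norm (y - x))\<^sup>2\<close>, so the same spatial bound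
      applies.\<close>
    have "I \<le> A / (t - \<tau>) * (t - \<tau>) powr (real CARD('n) / 2 + 1 - ?N) * ?G"
    proof (rule pv_heat_upper_bound[OF h _ pv, where b = 0 and v = v])
      show "A / (t - \<tau>) \<ge> 0" using A h by simp
      fix y
      have "u x t - u y \<tau> \<le> A / (t - \<tau>) * (t - \<tau>)" using far[OF \<tau>] h by simp
      also have "\<dots> \<le> A / (t - \<tau>) * ((t - \<tau>) + (norm (y - x))\<^sup>2)"
        using A h by (intro mult_left_mono) auto
      finally show "u x t - u y \<tau> \<le> A / (t - \<tau>) * ((t - \<tau>) + (norm (y - x))\<^sup>2) + 0 * ((y - x) \<bullet> v)"
        by simp
    qed
    also have "(t - \<tau>) powr (real CARD('n) / 2 + 1 - ?N) = (t - \<tau>) * (t - \<tau>) powr (- 1 - s)"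
      using h by (simp add: powr_mult_base)
    finally show ?thesis using False h by (simp add: time_kernel_def mult_ac)
  qed
  have shift: "integrable lebesgue (\<lambda>\<tau>. time_kernel s (t - \<tau>))"
    "(\<integral>\<tau>. time_kernel s (t - \<tau>) \<partial>lebesgue) = integral\<^sup>L lebesgue (time_kernel s)"
    using lebesgue_integrable_real_affine[OF integrable_time_kernel[OF s], of "-1" t]
      lebesgue_integral_real_affine[of "-1" "time_kernel s" t] by simp_all
  have "integral {..<t} F = (\<integral>\<tau>. indicator {..<t} \<tau> * F \<tau> \<partial>lebesgue)"
    using set_lebesgue_integral_eq_integral(2)[OF int] by (simp add: set_lebesgue_integral_def)
  also have "\<dots> \<le> (\<integral>\<tau>. A * ?G * time_kernel s (t - \<tau>) \<partial>lebesgue)"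
  proof (rule integral_mono_AE)
    show "integrable lebesgue (\<lambda>\<tau>. indicator {..<t} \<tau> * F \<tau>)"
      using int by (simp add: set_integrable_def)
    show "AE \<tau> in lebesgue. indicator {..<t} \<tau> * F \<tau> \<le> A * ?G * time_kernel s (t - \<tau>)"
      using F
    proof eventually_elim
      case (elim \<tau>)
      show ?case
      proof (cases "\<tau> < t")
        case True
        then show ?thesis using bound elim by simp
      next
        case False
        then show ?thesis by (simp add: time_kernel_def)
      qed
    qed
  qed (intro integrable_mult_right shift)
  also have "\<dots> = A * ?G * integral\<^sup>L lebesgue (time_kernel s)"
    by (simp add: shift)
  finally have "integral {..<t} F \<le> A * ?G * integral\<^sup>L lebesgue (time_kernel s)" .
  then have "c \<le> 1 / ((4 * pi) powr (real CARD('n) / 2) * \<bar>Gamma (- s)\<bar>) *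
      (A * ?G * integral\<^sup>L lebesgue (time_kernel s))"
    unfolding c by (intro mult_left_mono) auto
  then show ?thesis by (simp add: master_bound_def mult_ac)
qed

section \<open>Touching by a paraboloid and the contradiction\<close>

theorem theorem1p5:
  fixes s p :: real and k :: "'n::finite"
  assumes "0 < s" "s < 1" "0 < p" "p < 1"
  shows "\<not> (\<exists>u :: real ^ 'n \<Rightarrow> real \<Rightarrow> real.
            classical_solution s (\<lambda>x v. x $ k * v powr p) u \<and>
            (\<forall>x t. 0 < u x t) \<and>
            bdd_above (range (\<lambda>(x, t). u x t)) \<and>
            (\<forall>x y t. x $ k < y $ k \<and> (\<forall>i. i \<noteq> k \<longrightarrow> x $ i = y $ i) \<longrightarrow> u x t \<le> u y t))"
proof
  assume "\<exists>u :: real ^ 'n \<Rightarrow> real \<Rightarrow> real.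
            classical_solution s (\<lambda>x v. x $ k * v powr p) u \<and>
            (\<forall>x t. 0 < u x t) \<and>
            bdd_above (range (\<lambda>(x, t). u x t)) \<and>
            (\<forall>x y t. x $ k < y $ k \<and> (\<forall>i. i \<noteq> k \<longrightarrow> x $ i = y $ i) \<longrightarrow> u x t \<le> u y t)"
  then obtain u :: "real ^ 'n \<Rightarrow> real \<Rightarrow> real" and \<alpha> M where
    \<alpha>: "parabolic_holder_loc \<alpha> u"
    and op: "\<And>x t. has_master_op s u x t (x $ k * u x t powr p)"
    and pos: "\<And>x t. 0 < u x t" and bdd: "bdd_above (range (\<lambda>(x, t). u x t))"
    by (auto simp: classical_solution_def)
  from bdd obtain M where M: "u x t \<le> M" for x t
    by (auto simp: bdd_above_def)
  \<comment> \<open>\<open>B\<close> will bound \<open>x0 $ k\<close> from above and does not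
    involve \<open>a\<close>. Since \<open>x0\<close> lies within distance 1 of \<open>a\<close>,
    the choice \<open>a $ k = B + 2\<close> forces \<open>x0 $ k \<ge> B + 1\<close>.\<close>
  define B where "B = master_bound s TYPE('n) / (1 - p) * M powr (1 - p)"
  define a :: "real ^ 'n" where "a = axis k (B + 2)"
  define f where "f x t = t - (norm (x - a))\<^sup>2" for x t
  \<comment> \<open>\<open>K\<close> contains every point with \<open>t \<le> 1\<close> at which
    \<open>f\<close> is positive, so the maximum over \<open>K\<close> controls the whole
    past.\<close>
  define K where "K = cball a 1 \<times> {0..1::real}"
  have "continuous_on K (\<lambda>z. f (fst z) (snd z) / u (fst z) (snd z) powr (1 - p))"
    unfolding f_def using pos
    by (intro continuous_intros continuous_at_imp_continuous_on ballI parabolic_holder_loc_isCont[OF \<alpha>])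
      (auto simp: less_imp_neq[symmetric])
  moreover have "compact K" "(a, 1) \<in> K"
    by (auto simp: K_def intro: compact_Times)
  ultimately obtain x0 t0 where z0: "(x0, t0) \<in> K"
    and max: "\<And>x t. (x, t) \<in> K \<Longrightarrow> f x t / u x t powr (1 - p) \<le> f x0 t0 / u x0 t0 powr (1 - p)"
    using continuous_attains_sup[of K "\<lambda>z. f (fst z) (snd z) / u (fst z) (snd z) powr (1 - p)"]
    by fastforce
  define w where "w = u x0 t0 powr (1 - p)"
  define \<delta> where "\<delta> = w / f x0 t0"
  have w: "w > 0" using pos[of x0 t0] by (simp add: w_def)
  have t0: "0 \<le> t0" "t0 \<le> 1" and x0: "norm (x0 - a) \<le> 1"
    using z0 by (auto simp: K_def dist_norm norm_minus_commute)
  \<comment> \<open>Comparison with the vertex \<open>(a, 1)\<close>, where \<open>f\<close> equals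
    1, makes the maximum positive and bounds its reciprocal \<open>\<delta>\<close> independently of
    \<open>a\<close>.\<close>
  have "1 / M powr (1 - p) \<le> 1 / u a 1 powr (1 - p)"
    using pos[of a 1] M[of a 1] assms by (intro divide_left_mono powr_mono2) auto
  also have "\<dots> \<le> f x0 t0 / w"
    using max[OF \<open>(a, 1) \<in> K\<close>] by (simp add: f_def w_def)
  finally have Mw: "1 / M powr (1 - p) \<le> f x0 t0 / w" .
  have Mpos: "M powr (1 - p) > 0" using pos[of a 1] M[of a 1] by simp
  have f0: "f x0 t0 > 0"
    using less_le_trans[OF _ Mw, of 0] Mpos w by (simp add: zero_less_divide_iff)
  have f1: "f x0 t0 \<le> 1"
    using t0(2) zero_le_power2[of "norm (x0 - a)"] unfolding f_def by linarith
  have \<delta>: "\<delta> > 0" using w f0 by (simp add: \<delta>_def)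
  have \<delta>M: "\<delta> \<le> M powr (1 - p)"
    using Mw Mpos w f0 by (simp add: \<delta>_def field_simps)
  have below: "\<delta> * f y \<tau> \<le> u y \<tau> powr (1 - p)" if "\<tau> \<le> 1" for y \<tau>
  proof (cases "(y, \<tau>) \<in> K")
    case True
    from max[OF this] show ?thesis
      using w f0 pos[of y \<tau>] by (simp add: \<delta>_def field_simps flip: w_def)
  next
    case False
    then have "\<tau> < 0 \<or> 1 < norm (y - a)"
      using that by (auto simp: K_def dist_norm norm_minus_commute)
    then have "f y \<tau> \<le> 0"
    proof
      assume "1 < norm (y - a)"
      then have "1 < (norm (y - a))\<^sup>2" by (simp add: one_less_power)
      then show ?thesis using that by (simp add: f_def)
    qed (simp add: f_def add_nonneg_nonneg order.trans[OF less_imp_le])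
    then have "\<delta> * f y \<tau> \<le> 0" using \<delta> by (simp add: mult_nonneg_nonpos)
    also have "0 \<le> u y \<tau> powr (1 - p)" by simp
    finally show ?thesis .
  qed
  \<comment> \<open>The slope \<delta> of the touching inequality for \<open>u powr (1 - p)\<close>,
    converted by the tangent inequality into a slope for \<open>u\<close> itself.\<close>
  define A where "A = \<delta> * u x0 t0 powr p / (1 - p)"
  have A: "A \<ge> 0" using \<delta> assms by (simp add: A_def)
  have touch: "u x0 t0 - u y \<tau> \<le> A * (f x0 t0 - f y \<tau>)" if "\<tau> < t0" for y \<tau>
  proof -
    have "(1 - p) * (u x0 t0 - u y \<tau>) \<le> u x0 t0 powr p * (w - u y \<tau> powr (1 - p))"
      unfolding w_def using assms pos by (intro powr_concave_tangent) auto
    also have "\<dots> \<le> u x0 t0 powr p * (\<delta> * f x0 t0 - \<delta> * f y \<tau>)"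
      using below[of \<tau> y] that t0 f0 by (intro mult_left_mono diff_mono) (auto simp: \<delta>_def)
    finally show ?thesis
      using assms by (simp add: A_def field_simps)
  qed
  have far: "u x0 t0 - u y \<tau> \<le> A" for y \<tau>
  proof -
    have "u x0 t0 - u y \<tau> \<le> u x0 t0" using pos[of y \<tau>] by simp
    \<comment> \<open>At the touching point \<open>\<delta> * f x0 t0\<close> equals
      \<open>u x0 t0 powr (1 - p)\<close>.\<close>
    also have "\<dots> = u x0 t0 powr p * (\<delta> * f x0 t0)"
      using f0 pos[of x0 t0] by (simp add: \<delta>_def w_def flip: powr_add)
    also have "\<dots> \<le> u x0 t0 powr p * (\<delta> * 1)"
      using f1 \<delta> by (intro mult_left_mono) auto
    also have "\<dots> \<le> A"
      using assms \<delta> by (simp add: A_def field_simps)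
    finally show ?thesis .
  qed
  have "x0 $ k * u x0 t0 powr p \<le> master_bound s TYPE('n) * A"
  proof (rule master_op_upper_bound[OF assms(1,2) op A far])
    fix y \<tau> assume "\<tau> < t0"
    \<comment> \<open>Expanding the paraboloid about \<open>x0\<close> leaves a linear term with
      \<open>v = 2 *\<^sub>R (x0 - a)\<close>, which the principal value removes.\<close>
    have "(norm (y - a))\<^sup>2 = (norm (y - x0))\<^sup>2 + (y - x0) \<bullet> (2 *\<^sub>R (x0 - a)) + (norm (x0 - a))\<^sup>2"
      by (simp add: power2_norm_eq_inner inner_diff inner_commute algebra_simps)
    then have "f x0 t0 - f y \<tau> = (t0 - \<tau>) + (norm (y - x0))\<^sup>2 + (y - x0) \<bullet> (2 *\<^sub>R (x0 - a))"
      by (simp add: f_def)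
    with touch[OF \<open>\<tau> < t0\<close>, of y]
    show "u x0 t0 - u y \<tau> \<le> A * ((t0 - \<tau>) + (norm (y - x0))\<^sup>2 + (y - x0) \<bullet> (2 *\<^sub>R (x0 - a)))"
      by simp
  qed
  also have "\<dots> = master_bound s TYPE('n) / (1 - p) * \<delta> * u x0 t0 powr p"
    by (simp add: A_def)
  also have "\<dots> \<le> B * u x0 t0 powr p"
    unfolding B_def using \<delta>M assms master_bound_nonneg[of s, where ?'n = 'n]
    by (intro mult_right_mono mult_left_mono) auto
  \<comment> \<open>Both sides carry the factor \<open>u x0 t0 powr p\<close>, which cancels;
    comparing \<open>f\<close> with \<open>u powr (1 - p)\<close> was chosen for this.\<close>
  finally have "x0 $ k \<le> B" using pos[of x0 t0] by simp
  moreover have "\<bar>(x0 - a) $ k\<bar> \<le> 1" using component_le_norm_cart[of "x0 - a" k] x0 by linarith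
  ultimately show False by (simp add: a_def axis_def)
qed

end
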